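(* For every integer $n \ge 1$, let $\hat{e}_n$ and $\hat{o}_n$ denote the numbers of direct and indirect c-derangements of the $n$-dimensional hypercube $Q_n$, respectively. Then $\hat{e}_n - \hat{o}_n = (-1)^n$.
   Context: Let $Q_n$ be the regular $n$-dimensional hypercube, e.g. $[-1,1]^n\subset\mathbb{R}^n$; its $2n$ facets have centers $\pm e_1,\dots,\pm e_n$. Isometries of $Q_n$ correspond exactly to $n\times n$ signed permutation matrices (permutation matrices with nonzero entries $\pm1$). A c-derangement is an isometry of $Q_n$ fixing no facet, i.e. a signed permutation matrix with no entry $+1$ on its main diagonal. An isometry is direct if its matrix has determinant $1$ (equivalently, it is a product of an even number of reflections) and indirect if its determinant is $-1$. *)

theory Defs
  imports "HOL-Analysis.Analysis"
begin

definition hypercube :: "(real ^ 'n) set" where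
  "hypercube = {x. \<forall>i. - 1 \<le> x $ i \<and> x $ i \<le> 1}"

text \<open>The isometries of the cube are taken as isometries of the ambient Euclidean space that
  map the cube onto itself. Such a map is not required to be linear; it fixes the centre of the
  cube, which is the origin, and is therefore linear automatically.\<close>

definition cube_isometry :: "(real ^ 'n \<Rightarrow> real ^ 'n) \<Rightarrow> bool" where
  "cube_isometry f \<longleftrightarrow> (\<forall>x y. dist (f x) (f y) = dist x y) \<and> f ` hypercube = hypercube"

text \<open>Fixing a facet means mapping it onto itself as a set, not pointwise.\<close>

definition c_derangement :: "(real ^ 'n \<Rightarrow> real ^ 'n) \<Rightarrow> bool" where
  "c_derangement f \<longleftrightarrow> cube_isometry f \<and> (\<forall>F. F facet_of hypercube \<longrightarrow> f ` F \<noteq> F)"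

definition direct :: "(real ^ 'n \<Rightarrow> real ^ 'n) \<Rightarrow> bool" where
  "direct f \<longleftrightarrow> det (matrix f) = 1"

definition indirect :: "(real ^ 'n \<Rightarrow> real ^ 'n) \<Rightarrow> bool" where
  "indirect f \<longleftrightarrow> det (matrix f) = - 1"

text \<open>The dimension \<open>n\<close> is the cardinality of the index type, which is passed as a type
  argument.\<close>

definition e_hat :: "'n::finite itself \<Rightarrow> nat" where
  "e_hat _ = card {f :: real ^ 'n \<Rightarrow> real ^ 'n. c_derangement f \<and> direct f}"

definition o_hat :: "'n::finite itself \<Rightarrow> nat" where
  "o_hat _ = card {f :: real ^ 'n \<Rightarrow> real ^ 'n. c_derangement f \<and> indirect f}"

end

theory Submission
  imports Defs
begin

text \<open>An isometry of the cube fixes the centre, so it is orthogonal; every row of its matrix then has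
  Euclidean norm \<open>1\<close> and \<open>\<ell>\<^sup>1\<close>-norm at most \<open>1\<close>, hence it is a signed unit vector. Thus the
  c-derangements are the maps \<open>x \<mapsto> (s\<^sub>i x\<^bsub>p(i)\<^esub>)\<^sub>i\<close> with \<open>p\<close> a permutation, \<open>s\<^sub>i = -1\<close> at the fixed points
  of \<open>p\<close> and \<open>s\<^sub>i\<close> an arbitrary sign elsewhere. Summing the determinant
  \<open>sign p \<cdot> \<Prod>\<^sub>i s\<^sub>i\<close> over the signs first, every index not fixed by \<open>p\<close> contributes a factor
  \<open>1 + (-1) = 0\<close>, so only \<open>p = id\<close> survives, with the value \<open>(-1)\<^sup>n\<close>.\<close>

section \<open>Signed permutation maps\<close>

definition signed_perm :: "('n \<Rightarrow> 'n) \<Rightarrow> ('n \<Rightarrow> real) \<Rightarrow> real ^ 'n \<Rightarrow> real ^ 'n::finite" where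
  "signed_perm p s x = (\<chi> i. s i * x $ p i)"

lemma signed_perm_nth [simp]: "signed_perm p s x $ i = s i * x $ p i"
  by (simp add: signed_perm_def)

text \<open>The matrix is written as rescaled, permuted rows of the identity, so its determinant
  follows from row permutation and row scaling.\<close>

lemma matrix_signed_perm: "matrix (signed_perm p s) = (\<chi> i. s i *s (mat 1 $ p i))"
  by (auto simp: vec_eq_iff matrix_def axis_def mat_def)

lemma det_signed_perm:
  fixes p :: "'n::finite \<Rightarrow> 'n"
  assumes "p permutes UNIV"
  shows "det (matrix (signed_perm p s)) = of_int (sign p) * (\<Prod>i\<in>UNIV. s i)"
  using det_permute_rows[OF assms, of "mat 1 :: real^'n^'n"]
  by (simp add: matrix_signed_perm det_rows_mul)

text \<open>Evaluating both maps at \<open>axis k 1\<close> compares the \<open>k\<close>-th columns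
  of their matrices; for \<open>k = p i\<close> the entry \<open>s i\<close> is nonzero, which
  forces \<open>q i = p i\<close>.\<close>

lemma signed_perm_eqD:
  assumes "signed_perm p s = signed_perm q t" and "\<And>i. s i \<noteq> 0"
  shows "p = q \<and> s = t"
proof -
  have *: "s i * axis k 1 $ p i = t i * axis k 1 $ q i" for i k
    by (metis assms(1) signed_perm_nth)
  have "p i = q i" for i
    using *[of i "p i"] assms(2)[of i] by (auto simp: axis_def split: if_splits)
  moreover have "s i = t i" for i
    using *[of i "p i"] \<open>p i = q i\<close> by simp
  ultimately show ?thesis by auto
qed

lemma signed_perm_orthogonal:
  assumes p: "p permutes UNIV" and s: "\<And>i. \<bar>s i\<bar> = 1"
  shows "orthogonal_transformation (signed_perm p s)"
proof -
  have "(s i)\<^sup>2 = 1" for i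
    using s[of i] by (metis one_power2 power2_abs)
  then have "signed_perm p s v \<bullet> signed_perm p s w = (\<Sum>i\<in>UNIV. v $ p i * w $ p i)" for v w
    by (auto simp: inner_vec_def power2_eq_square mult.assoc mult.left_commute intro!: sum.cong)
  also have "\<dots> v w = v \<bullet> w" for v w
    using sum.permute[OF p, of "\<lambda>i. v $ i * w $ i"] by (simp add: inner_vec_def o_def)
  finally show ?thesis
    unfolding orthogonal_transformation_def
    by (auto simp: linear_iff vec_eq_iff algebra_simps)
qed

lemma mem_hypercube_iff: "x \<in> hypercube \<longleftrightarrow> (\<forall>i. \<bar>x $ i\<bar> \<le> 1)"
  by (force simp: hypercube_def abs_le_iff)

lemma signed_perm_mem_hypercube:
  assumes p: "p permutes UNIV" and s: "\<And>i. \<bar>s i\<bar> = 1"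
  shows "signed_perm p s x \<in> hypercube \<longleftrightarrow> x \<in> hypercube"
proof -
  have "signed_perm p s x \<in> hypercube \<longleftrightarrow> (\<forall>i. \<bar>x $ p i\<bar> \<le> 1)"
    by (simp add: mem_hypercube_iff abs_mult s)
  also have "\<dots> \<longleftrightarrow> (\<forall>i. \<bar>x $ i\<bar> \<le> 1)"
    by (metis p permutes_surj surjD)
  finally show ?thesis
    by (simp add: mem_hypercube_iff)
qed

lemma signed_perm_cube_isometry:
  assumes "p permutes UNIV" and "\<And>i. \<bar>s i\<bar> = 1"
  shows "cube_isometry (signed_perm p s)"
proof -
  note orth = signed_perm_orthogonal[of p s, OF assms]
  have "signed_perm p s -` hypercube = hypercube"
    using signed_perm_mem_hypercube[of p s, OF assms] by blast
  then have "signed_perm p s ` hypercube = hypercube"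
    by (metis orth orthogonal_transformation_surj surj_image_vimage_eq)
  then show ?thesis
    using orth by (simp add: cube_isometry_def orthogonal_transformation_isometry)
qed

section \<open>Cube isometries are signed permutations\<close>

lemma cube_isometry_0:
  fixes f :: "real ^ 'n \<Rightarrow> real ^ 'n"
  assumes "cube_isometry f"
  shows "f 0 = 0"
proof (rule ccontr)
  assume "f 0 \<noteq> 0"
  then obtain k where k: "f 0 $ k \<noteq> 0"
    by (metis vec_eq_iff zero_index)
  txt \<open>The vertex of the orthant opposite to \<open>f 0\<close> is farther from \<open>f 0\<close> than any point of the cube is
    from the centre.\<close>
  define v :: "real ^ 'n" where "v = (\<chi> i. if f 0 $ i > 0 then - 1 else 1)"
  have "v \<in> hypercube"
    by (simp add: v_def hypercube_def)
  then obtain x where x: "x \<in> hypercube" "f x = v"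
    using assms unfolding cube_isometry_def by (metis imageE)
  have "dist 0 x = dist (f 0) v"
    using assms x unfolding cube_isometry_def by metis
  then have "norm x = norm (v - f 0)"
    by (simp add: dist_norm norm_minus_commute)
  then have "x \<bullet> x = (v - f 0) \<bullet> (v - f 0)"
    by (simp add: norm_eq_sqrt_inner)
  moreover have "(\<Sum>i\<in>UNIV. x $ i * x $ i) < (\<Sum>i\<in>UNIV. (v - f 0) $ i * (v - f 0) $ i)"
  proof (rule sum_strict_mono_ex1)
    have le: "x $ i * x $ i \<le> 1" for i
      using x(1) abs_le_square_iff[of "x $ i" 1] by (auto simp: mem_hypercube_iff power2_eq_square)
    \<comment> \<open>By the choice of signs in \<open>v\<close>, the right side is
      \<open>(1 + \<bar>f 0 $ i\<bar>)^2\<close>.\<close>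
    have ge: "1 + f 0 $ i * f 0 $ i \<le> (v - f 0) $ i * (v - f 0) $ i" for i
      by (auto simp: v_def algebra_simps)
    show "\<forall>i\<in>UNIV. x $ i * x $ i \<le> (v - f 0) $ i * (v - f 0) $ i"
      using le ge by (smt (verit) zero_le_square)
    show "\<exists>i\<in>UNIV. x $ i * x $ i < (v - f 0) $ i * (v - f 0) $ i"
      using le[of k] ge[of k] k by (smt (verit) UNIV_I mult_eq_0_iff zero_le_square)
  qed simp
  ultimately show False
    by (simp add: inner_vec_def)
qed

text \<open>All entries have modulus at most 1, so \<open>(a $ i)^2 \<le> \<bar>a $ i\<bar>\<close>.
  The two sums are 1 and at most 1, so equality holds termwise and every modulus is 0 or 1; two
  nonzero entries would give a sum of at least 2.\<close>

lemma unit_vector_of_norms: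
  fixes a :: "real ^ 'n"
  assumes norm: "norm a = 1" and sum: "(\<Sum>i\<in>UNIV. \<bar>a $ i\<bar>) \<le> 1"
  obtains k t where "\<bar>t\<bar> = 1" "a = t *\<^sub>R axis k 1"
proof -
  have sq: "(\<Sum>i\<in>UNIV. (a $ i)\<^sup>2) = 1"
    using norm by (simp add: norm_vec_def L2_set_def)
  have le: "(a $ i)\<^sup>2 \<le> \<bar>a $ i\<bar>" for i
    using component_le_norm_cart[of a i] norm
    by (metis abs_ge_zero mult_left_le power2_abs power2_eq_square)
  have "(\<Sum>i\<in>UNIV. \<bar>a $ i\<bar> - (a $ i)\<^sup>2) = 0"
    using sum sq sum_nonneg[of UNIV "\<lambda>i. \<bar>a $ i\<bar> - (a $ i)\<^sup>2"] le by (simp add: sum_subtractf)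
  then have "\<bar>a $ i\<bar> = (a $ i)\<^sup>2" for i
    by (subst (asm) sum_nonneg_eq_0_iff) (auto simp: le)
  then have abs01: "\<bar>a $ i\<bar> = 0 \<or> \<bar>a $ i\<bar> = 1" for i
    by (metis mult_cancel_right2 power2_abs power2_eq_square)
  obtain k where k: "a $ k \<noteq> 0"
    using norm by (metis norm_zero vec_eq_iff zero_index zero_neq_one)
  have "a $ i = 0" if "i \<noteq> k" for i
    using sum_mono2[of UNIV "{i, k}" "\<lambda>i. \<bar>a $ i\<bar>"] that sum abs01[of i] abs01[of k] k by auto
  then have "a = (a $ k) *\<^sub>R axis k 1"
    by (auto simp: vec_eq_iff axis_def)
  with abs01[of k] k that show thesis by auto
qed

lemma cube_isometry_signed_perm:
  fixes f :: "real ^ 'n \<Rightarrow> real ^ 'n"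
  assumes f: "cube_isometry f"
  obtains p s where "p permutes UNIV" "\<And>i. \<bar>s i\<bar> = 1" "f = signed_perm p s"
proof -
  have orth: "orthogonal_transformation f"
    using f cube_isometry_0[OF f]
    by (simp add: cube_isometry_def orthogonal_transformation_isometry)
  define A where "A = matrix f"
  have fA: "f x $ i = A $ i \<bullet> x" for x i
    using orth by (metis A_def matrix_vector_mul(2) matrix_vector_mul_component
        orthogonal_transformation_linear)
  have "\<exists>k t. \<bar>t\<bar> = 1 \<and> A $ i = t *\<^sub>R axis k 1" for i
  proof -
    have "norm (A $ i) = 1"
      using orth unfolding A_def orthogonal_transformation_matrix
      by (auto simp: orthogonal_matrix_orthonormal_rows row_def)
    moreover have "(\<Sum>j\<in>UNIV. \<bar>A $ i $ j\<bar>) \<le> 1"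
    proof -
      \<comment> \<open>At this point of the cube the \<open>i\<close>-th coordinate of
        \<open>f\<close> equals the sum of moduli of row \<open>i\<close>.\<close>
      define v :: "real ^ 'n" where "v = (\<chi> j. sgn (A $ i $ j))"
      have "v \<in> hypercube"
        by (simp add: v_def hypercube_def sgn_if)
      then have "f v \<in> hypercube"
        using f unfolding cube_isometry_def by blast
      moreover have "(\<Sum>j\<in>UNIV. \<bar>A $ i $ j\<bar>) = f v $ i"
        by (simp add: fA inner_vec_def v_def abs_sgn)
      ultimately show ?thesis
        by (simp add: hypercube_def)
    qed
    ultimately show ?thesis
      by (metis unit_vector_of_norms)
  qed
  then obtain p s where s: "\<And>i. \<bar>s i\<bar> = 1" and A: "\<And>i. A $ i = s i *\<^sub>R axis (p i) 1"
    by metis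
  have f_eq: "f = signed_perm p s"
    by (auto simp: fun_eq_iff vec_eq_iff fA A inner_axis')
  \<comment> \<open>A missed index would give a zero column, against preservation of norms.\<close>
  have "k \<in> range p" for k
  proof (rule ccontr)
    assume "k \<notin> range p"
    then have "f (axis k 1) = 0"
      by (auto simp: f_eq vec_eq_iff axis_def)
    then show False
      using orthogonal_transformation_norm[OF orth, of "axis k 1"] by simp
  qed
  then have "bij p"
    using finite_UNIV_surj_inj[of p] by (auto simp: bij_def)
  then have "p permutes UNIV"
    by (intro bij_imp_permutes) auto
  with s f_eq that show thesis by blast
qed

section \<open>Facets of the cube\<close>

lemma hypercube_eq_cbox: "(hypercube :: (real ^ 'n) set) = cbox (\<chi> i. - 1) (\<chi> i. 1)"
  by (auto simp: hypercube_def mem_box_cart)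

definition cube_facet :: "'n \<Rightarrow> real \<Rightarrow> (real ^ 'n::finite) set" where
  "cube_facet i t = {x \<in> hypercube. x $ i = t}"

lemma cube_facet_subsetD:
  assumes sub: "cube_facet i t \<subseteq> cube_facet j u" and "\<bar>t\<bar> = 1" "\<bar>u\<bar> = 1"
  shows "i = j \<and> t = u"
proof -
  \<comment> \<open>The witness is the centre of \<open>cube_facet i t\<close>.\<close>
  have mem: "(\<chi> k. if k = i then t else 0) \<in> cube_facet i t"
    using assms by (auto simp: cube_facet_def hypercube_def)
  with sub have "(if j = i then t else 0) = u"
    by (auto simp: cube_facet_def)
  then show ?thesis
    using assms by (auto split: if_splits)
qed

lemma cube_facet_face_of:
  fixes i :: "'n::finite"
  assumes "\<bar>t\<bar> = 1"
  shows "cube_facet i t face_of hypercube"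
proof -
  have "cube_facet i t = hypercube \<inter> {x. (t *\<^sub>R axis i 1) \<bullet> x = 1}"
    using assms by (auto simp: cube_facet_def inner_axis' abs_if split: if_splits)
  moreover have "(t *\<^sub>R axis i 1) \<bullet> x \<le> 1" if "x \<in> hypercube" for x :: "real ^ 'n"
  proof -
    have "- 1 \<le> x $ i" "x $ i \<le> 1"
      using that by (auto simp: hypercube_def)
    then show ?thesis
      using assms by (auto simp: inner_axis' abs_if split: if_splits)
  qed
  ultimately show ?thesis
    using face_of_Int_supporting_hyperplane_le[of hypercube "t *\<^sub>R axis i 1" 1]
    by (simp add: hypercube_eq_cbox)
qed

lemma cube_facet_neq_hypercube:
  assumes "\<bar>t\<bar> = 1"
  shows "cube_facet i t \<noteq> hypercube"
proof -
  have "0 \<in> hypercube" "0 \<notin> cube_facet i t"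
    using assms by (auto simp: hypercube_def cube_facet_def)
  then show ?thesis by blast
qed

text \<open>A facet of a polyhedron is where some functional \<open>a\<close> attains its maximum. A
  coordinate with \<open>a $ i \<noteq> 0\<close> must then be extremal, which puts the facet inside
  some \<open>cube_facet i t\<close>; comparing dimensions gives equality.\<close>

lemma facet_of_hypercubeE:
  fixes F :: "(real ^ 'n) set"
  assumes F: "F facet_of hypercube"
  obtains i t where "\<bar>t\<bar> = 1" "F = cube_facet i t"
proof -
  let ?Q = "hypercube :: (real ^ 'n) set"
  have "F exposed_face_of ?Q"
    using F by (simp add: hypercube_eq_cbox exposed_face_of_polyhedron facet_of_imp_face_of)
  then obtain a b where ab: "?Q \<subseteq> {x. a \<bullet> x \<le> b}" "F = ?Q \<inter> {x. a \<bullet> x = b}"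
    unfolding exposed_face_of_def by blast
  have "F \<noteq> {}" "F \<noteq> ?Q"
    using F by (auto simp: facet_of_def)
  then obtain y where y: "y \<in> ?Q" "a \<bullet> y = b"
    using ab by blast
  have "a \<noteq> 0"
    \<comment> \<open>If \<open>a\<close> were 0, then \<open>b = a \<bullet> y\<close> would be 0
      and \<open>F\<close> the whole cube.\<close>
    using ab y \<open>F \<noteq> ?Q\<close> by auto
  then obtain i where i: "a $ i \<noteq> 0"
    by (metis vec_eq_iff zero_index)
  define t where "t = sgn (a $ i)"
  have t: "\<bar>t\<bar> = 1"
    using i by (simp add: t_def abs_sgn_eq)
  have sub: "F \<subseteq> cube_facet i t"
  proof
    fix x assume x: "x \<in> F"
    then have xQ: "x \<in> ?Q" "a \<bullet> x = b"
      using ab by auto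
    txt \<open>Otherwise moving the \<open>i\<close>-th coordinate of \<open>x\<close> to \<open>t\<close> increases \<open>a \<bullet> x\<close> beyond its maximum \<open>b\<close>.\<close>
    define z where "z = x + (t - x $ i) *\<^sub>R axis i 1"
    have "z \<in> ?Q"
      using xQ t by (auto simp: z_def hypercube_def axis_def abs_if split: if_splits)
    then have "a \<bullet> z \<le> b"
      using ab by blast
    then have "(t - x $ i) * a $ i \<le> 0"
      using xQ by (simp add: z_def inner_right_distrib inner_axis)
    moreover have "- 1 \<le> x $ i" "x $ i \<le> 1"
      using xQ by (auto simp: hypercube_def)
    ultimately have "x $ i = t"
      using i by (auto simp: t_def sgn_if mult_le_0_iff split: if_splits)
    then show "x \<in> cube_facet i t"
      using xQ by (simp add: cube_facet_def)
  qed
  have face: "cube_facet i t face_of ?Q"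
    using cube_facet_face_of[OF t] .
  have conv: "convex ?Q"
    by (simp add: hypercube_eq_cbox)
  \<comment> \<open>A proper face of \<open>cube_facet i t\<close> would lie at least two dimensions
    below the cube, one too many for a facet.\<close>
  have "F face_of cube_facet i t"
    using face_of_subset[OF facet_of_imp_face_of[OF F] sub] by (auto simp: cube_facet_def)
  moreover have "aff_dim (cube_facet i t) < aff_dim ?Q"
    using face_of_aff_dim_lt[OF conv face] cube_facet_neq_hypercube[OF t] by blast
  moreover have "aff_dim F = aff_dim ?Q - 1"
    using F by (simp add: facet_of_def)
  ultimately have "F = cube_facet i t"
    using face_of_aff_dim_lt[OF face_of_imp_convex[OF face], of F] by force
  with t that show thesis by blast
qed

text \<open>No dimension is computed: a nonempty proper face lies in some facet, that facet is
  itself some \<open>cube_facet j u\<close>, and inclusion between two such sets forces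
  equality.\<close>

lemma cube_facet_facet_of:
  fixes i :: "'n::finite"
  assumes t: "\<bar>t\<bar> = 1"
  shows "cube_facet i t facet_of hypercube"
proof -
  have "(\<chi> k. t) \<in> cube_facet i t"
    using t by (auto simp: cube_facet_def hypercube_def)
  then obtain F where F: "F facet_of hypercube" "cube_facet i t \<subseteq> F"
    using face_of_polyhedron_subset_facet[of hypercube "cube_facet i t"]
      cube_facet_face_of[OF t] cube_facet_neq_hypercube[OF t]
    by (metis empty_iff hypercube_eq_cbox polyhedron_interval)
  obtain j u where "\<bar>u\<bar> = 1" "F = cube_facet j u"
    using facet_of_hypercubeE[OF F(1)] .
  then show ?thesis
    using F cube_facet_subsetD[of i t j u] t by auto
qed

section \<open>c-derangements as signed permutations\<close>

text \<open>Coordinate \<open>i\<close> of the image reads coordinate \<open>p i\<close> of the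
  argument; putting \<open>p i\<close> on the source side avoids the inverse of
  \<open>p\<close>.\<close>

lemma signed_perm_image_cube_facet:
  assumes p: "p permutes UNIV" and s: "\<And>i. \<bar>s i\<bar> = 1"
  shows "signed_perm p s ` cube_facet (p i) t = cube_facet i (s i * t)"
proof (intro set_eqI iffI)
  fix y assume "y \<in> signed_perm p s ` cube_facet (p i) t"
  then show "y \<in> cube_facet i (s i * t)"
    by (auto simp: cube_facet_def signed_perm_mem_hypercube[of p s, OF assms])
next
  fix y assume y: "y \<in> cube_facet i (s i * t)"
  obtain x where x: "y = signed_perm p s x"
    using surjD[OF orthogonal_transformation_surj[OF signed_perm_orthogonal[of p s, OF assms]]]
    by blast
  have "s i \<noteq> 0"
    using s[of i] by auto
  with y have "x \<in> cube_facet (p i) t"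
    by (auto simp: x cube_facet_def signed_perm_mem_hypercube[of p s, OF assms])
  then show "y \<in> signed_perm p s ` cube_facet (p i) t"
    using x by blast
qed

lemma c_derangement_signed_perm:
  assumes p: "p permutes UNIV" and s: "\<And>i. \<bar>s i\<bar> = 1"
  shows "c_derangement (signed_perm p s) \<longleftrightarrow> (\<forall>i. p i = i \<longrightarrow> s i = - 1)"
proof
  assume c: "c_derangement (signed_perm p s)"
  show "\<forall>i. p i = i \<longrightarrow> s i = - 1"
  proof (intro allI impI)
    fix i assume "p i = i"
    then have "s i \<noteq> 1"
      using c cube_facet_facet_of[of 1 i]
        signed_perm_image_cube_facet[of p s i 1, OF assms]
      by (auto simp: c_derangement_def)
    then show "s i = - 1"
      using s[of i] by (simp add: abs_if split: if_splits)
  qed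
next
  assume *: "\<forall>i. p i = i \<longrightarrow> s i = - 1"
  have "signed_perm p s ` F \<noteq> F" if F: "F facet_of hypercube" for F
  proof
    assume eq: "signed_perm p s ` F = F"
    obtain j t where t: "\<bar>t\<bar> = 1" "F = cube_facet j t"
      using facet_of_hypercubeE[OF F] .
    obtain i where i: "j = p i"
      using p by (metis permutes_surj surjD)
    have "cube_facet i (s i * t) \<subseteq> cube_facet (p i) t"
      using eq signed_perm_image_cube_facet[of p s i t, OF assms] by (simp add: t i)
    then have "i = p i \<and> s i * t = t"
      by (rule cube_facet_subsetD) (simp_all add: abs_mult s t)
    then show False
      using * t(1) by (metis abs_zero mult_cancel_right1 one_neq_neg_one zero_neq_one)
  qed
  then show "c_derangement (signed_perm p s)"
    using signed_perm_cube_isometry[of p s, OF assms] by (simp add: c_derangement_def)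
qed

text \<open>For fixed \<open>p\<close> the constraints on different indices are independent, so the
  admissible sign functions form a product set.\<close>

definition derangement_signs :: "('n \<Rightarrow> 'n) \<Rightarrow> 'n \<Rightarrow> real set" where
  "derangement_signs p i = (if p i = i then {- 1} else {1, - 1})"

lemma c_derangements_eq:
  "{f :: real ^ 'n \<Rightarrow> real ^ 'n. c_derangement f} =
    (\<lambda>(p, s). signed_perm p s) ` (SIGMA p:{p. p permutes UNIV}. PiE UNIV (derangement_signs p))"
    (is "?C = ?R")
proof (intro set_eqI iffI)
  fix f :: "real ^ 'n \<Rightarrow> real ^ 'n"
  assume f: "f \<in> ?C"
  then obtain p s where ps: "p permutes UNIV" "\<And>i. \<bar>s i\<bar> = 1" "f = signed_perm p s"
    using cube_isometry_signed_perm[of f] by (auto simp: c_derangement_def)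
  have "s i \<in> derangement_signs p i" for i
    using f c_derangement_signed_perm[of p s, OF ps(1,2)] ps(2)[of i]
    by (auto simp: ps(3) derangement_signs_def abs_if split: if_splits)
  then show "f \<in> ?R"
    using ps by (force simp: PiE_UNIV_domain)
next
  fix f :: "real ^ 'n \<Rightarrow> real ^ 'n"
  assume "f \<in> ?R"
  then obtain p s where ps: "p permutes UNIV" "\<And>i. s i \<in> derangement_signs p i"
      "f = signed_perm p s"
    by (auto simp: PiE_UNIV_domain)
  have "\<bar>s i\<bar> = 1" and "p i = i \<longrightarrow> s i = - 1" for i
    using ps(2)[of i] by (auto simp: derangement_signs_def split: if_splits)
  then show "f \<in> ?C"
    using c_derangement_signed_perm[of p s, OF ps(1)] ps(3) by simp
qed

lemma inj_on_signed_perm: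
  "inj_on (\<lambda>(p, s). signed_perm p s)
    (SIGMA p:{p. p permutes (UNIV :: 'n::finite set)}. PiE UNIV (derangement_signs p))"
proof (rule inj_onI, clarify)
  fix p q :: "'n \<Rightarrow> 'n" and s t
  assume "signed_perm p s = signed_perm q t" and s: "s \<in> PiE UNIV (derangement_signs p)"
  moreover have "s i \<noteq> 0" for i
    using PiE_mem[OF s, of i] by (auto simp: derangement_signs_def split: if_splits)
  ultimately show "p = q \<and> s = t"
    by (intro signed_perm_eqD)
qed

section \<open>The determinant sum\<close>

lemma sum_det_c_derangements:
  "(\<Sum>f | c_derangement (f :: real ^ 'n \<Rightarrow> real ^ 'n). det (matrix f)) = (- 1) ^ CARD('n)"
proof -
  let ?P = "{p. p permutes (UNIV :: 'n set)}"
  have prod0: "(\<Prod>i\<in>UNIV. \<Sum>t\<in>derangement_signs p i. t) = 0" if "p \<noteq> id" for p :: "'n \<Rightarrow> 'n"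
    using that by (auto simp: derangement_signs_def fun_eq_iff prod_zero_iff)
  have "(\<Sum>f | c_derangement (f :: real ^ 'n \<Rightarrow> real ^ 'n). det (matrix f)) =
      (\<Sum>(p, s)\<in>(SIGMA p:?P. PiE UNIV (derangement_signs p)). det (matrix (signed_perm p s)))"
    unfolding c_derangements_eq sum.reindex[OF inj_on_signed_perm]
    by (simp add: o_def case_prod_unfold)
  also have "\<dots> = (\<Sum>p\<in>?P. \<Sum>s\<in>PiE UNIV (derangement_signs p). det (matrix (signed_perm p s)))"
    by (subst sum.Sigma) (auto simp: derangement_signs_def finite_permutations intro!: finite_PiE)
  also have "\<dots> = (\<Sum>p\<in>?P. of_int (sign p) * (\<Prod>i\<in>UNIV. \<Sum>t\<in>derangement_signs p i. t))"
  proof (rule sum.cong[OF refl])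
    fix p assume "p \<in> ?P"
    then show "(\<Sum>s\<in>PiE UNIV (derangement_signs p). det (matrix (signed_perm p s))) =
        of_int (sign p) * (\<Prod>i\<in>UNIV. \<Sum>t\<in>derangement_signs p i. t)"
      \<comment> \<open>The distributive law expands the product of sums into a sum over all choices
        of signs.\<close>
      by (subst prod_sum_PiE) (auto simp: derangement_signs_def det_signed_perm sum_distrib_left)
  qed
  also have "\<dots> = (\<Sum>p\<in>{id :: 'n \<Rightarrow> 'n}. of_int (sign p) *
      (\<Prod>i\<in>UNIV. \<Sum>t\<in>derangement_signs p i. t))"
    by (rule sum.mono_neutral_right) (auto simp: permutes_id prod0 finite_permutations)
  also have "\<dots> = (- 1) ^ CARD('n)"
    by (simp add: derangement_signs_def)
  finally show ?thesis .
qed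

theorem theorem4p3:
  "int (e_hat TYPE('n::finite)) - int (o_hat TYPE('n)) = (- 1) ^ CARD('n)"
proof -
  let ?C = "{f :: real ^ 'n \<Rightarrow> real ^ 'n. c_derangement f}"
  let ?E = "{f \<in> ?C. direct f}" and ?O = "{f \<in> ?C. indirect f}"
  have fin: "finite ?C"
    unfolding c_derangements_eq
    by (intro finite_imageI finite_SigmaI finite_PiE)
      (auto simp: derangement_signs_def finite_permutations)
  \<comment> \<open>Orthogonality leaves only the determinants 1 and -1, so the direct and indirect
    maps exhaust the c-derangements and the determinant sum counts them with sign.\<close>
  have "f \<in> ?E \<union> ?O" if "f \<in> ?C" for f
  proof -
    have "orthogonal_transformation f"
      using that cube_isometry_0[of f]
      by (simp add: c_derangement_def cube_isometry_def orthogonal_transformation_isometry)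
    then have "det (matrix f) = 1 \<or> det (matrix f) = - 1"
      by (simp add: orthogonal_transformation_matrix det_orthogonal_matrix)
    with that show ?thesis
      by (auto simp: direct_def indirect_def)
  qed
  then have "(\<Sum>f\<in>?C. det (matrix f)) = (\<Sum>f\<in>?E \<union> ?O. det (matrix f))"
    by (intro sum.cong) auto
  also have "\<dots> = (\<Sum>f\<in>?E. det (matrix f)) + (\<Sum>f\<in>?O. det (matrix f))"
    using fin by (intro sum.union_disjoint) (auto simp: direct_def indirect_def)
  also have "\<dots> = real (card ?E) - real (card ?O)"
    by (simp add: direct_def indirect_def)
  \<comment> \<open>Determinants are real, so the identity is first obtained in the reals and then
    pulled back along the injective \<open>of_int\<close>.\<close>
  finally have "real_of_int (int (e_hat TYPE('n)) - int (o_hat TYPE('n))) =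
      real_of_int ((- 1) ^ CARD('n))"
    by (simp add: sum_det_c_derangements e_hat_def o_hat_def)
  then show ?thesis
    by (simp only: of_int_eq_iff)
qed

end
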